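(* Given a graph $G=(V,E)$, let $A$ and $B$ refer to the equality and inequality constraint matrices (respectively) of the fractional coloring polytope of $G$. Then $\kappa(A,B)\in\Omega(2^{|V|})$, even for a constant number of colors.
   Context: The fractional coloring polytope of a graph $G=(V,E)$ and a finite color set $\tau$ is the set of $x\in\mathbb{R}^{V\times\tau}$ satisfying $$\sum_{i\in\tau}x(v,i)=1\ \ \forall v\in V,\qquad x(v,i)+x(u,i)\le 1\ \ \forall i\in\tau,\ uv\in E,\qquad x(v,i)\ge 0\ \ \forall v\in V,\ i\in\tau.$$ For matrices $A,B$ with the same number of columns, the set of circuits $\mathcal{C}(A,B)$ consists of the vectors $g\in\ker(A)\setminus\{0\}$, normalized to coprime integer components, for which $Bg$ is support-minimal over $\{Bx : x\in\ker(A)\setminus\{0\}\}$. The circuit imbalance measure is $\kappa(A,B)=\max\{|g(i)/g(j)| : g\in\mathcal{C}(A,B),\ g(j)\neq0\}$. For $f,g:\mathbb{Z}^+\to\mathbb{R}^+$, $f(n)\in\Omega(g(n))$ means that there exist a real constant $c>0$ and an integer constant $n_0\ge1$ such that $f(n)\ge c\cdot g(n)$ for every integer $n\ge n_0$. The bound is a worst-case statement over graphs: $\kappa(A,B)$ is regarded as a function of the number $|V|$ of vertices by taking the maximum over graphs with that number of vertices, and "a constant number of colors" means that $|\tau|$ may be a fixed constant independent of $|V|$. *)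

theory Defs
  imports Complex_Main "HOL-Library.Landau_Symbols"
begin

section \<open>Circuits and the circuit imbalance measure\<close>

text \<open>
  A matrix is a function from row and column indices, used together with its finite row index set
  and its finite column index set. A vector of \<open>\<real>\<^sup>C\<close> is a function that vanishes outside \<open>C\<close>,
  so that equality of functions is equality of vectors.
\<close>

definition vectors :: "'c set \<Rightarrow> ('c \<Rightarrow> real) set" where
  "vectors C = {x. \<forall>c. c \<notin> C \<longrightarrow> x c = 0}"

definition mat_vec :: "'c set \<Rightarrow> ('r \<Rightarrow> 'c \<Rightarrow> real) \<Rightarrow> ('c \<Rightarrow> real) \<Rightarrow> 'r \<Rightarrow> real" where
  "mat_vec C M x r = (\<Sum>c\<in>C. M r c * x c)"

definition mat_ker :: "'r set \<Rightarrow> 'c set \<Rightarrow> ('r \<Rightarrow> 'c \<Rightarrow> real) \<Rightarrow> ('c \<Rightarrow> real) set" where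
  "mat_ker R C A = {x \<in> vectors C. \<forall>r\<in>R. mat_vec C A x r = 0}"

definition support :: "'r set \<Rightarrow> ('r \<Rightarrow> real) \<Rightarrow> 'r set" where
  "support R y = {r \<in> R. y r \<noteq> 0}"

definition coprime_integral :: "'c set \<Rightarrow> ('c \<Rightarrow> real) \<Rightarrow> bool" where
  "coprime_integral C g \<longleftrightarrow>
     (\<exists>z :: 'c \<Rightarrow> int. (\<forall>c\<in>C. g c = of_int (z c)) \<and> Gcd (z ` C) = 1)"

text \<open>\<open>RA\<close> and \<open>RB\<close> are the row index sets of \<open>A\<close> and \<open>B\<close>; \<open>C\<close> is their common column index set.\<close>

definition circuits ::
  "'c set \<Rightarrow> 'a set \<Rightarrow> ('a \<Rightarrow> 'c \<Rightarrow> real) \<Rightarrow> 'b set \<Rightarrow> ('b \<Rightarrow> 'c \<Rightarrow> real) \<Rightarrow> ('c \<Rightarrow> real) set" where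
  "circuits C RA A RB B =
     {g \<in> mat_ker RA C A - {\<lambda>_. 0}.
        coprime_integral C g \<and>
        \<not> (\<exists>x \<in> mat_ker RA C A - {\<lambda>_. 0}.
              support RB (mat_vec C B x) \<subset> support RB (mat_vec C B g))}"

definition circuit_imbalance ::
  "'c set \<Rightarrow> 'a set \<Rightarrow> ('a \<Rightarrow> 'c \<Rightarrow> real) \<Rightarrow> 'b set \<Rightarrow> ('b \<Rightarrow> 'c \<Rightarrow> real) \<Rightarrow> real" where
  "circuit_imbalance C RA A RB B =
     Max {\<bar>g i / g j\<bar> | g i j. g \<in> circuits C RA A RB B \<and> i \<in> C \<and> j \<in> C \<and> g j \<noteq> 0}"


section \<open>The fractional coloring polytope\<close>

definition simple_graph :: "'v set \<Rightarrow> 'v set set \<Rightarrow> bool" where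
  "simple_graph V E \<longleftrightarrow> finite V \<and> (\<forall>e\<in>E. e \<subseteq> V \<and> card e = 2)"

definition fractional_coloring_polytope ::
  "'v set \<Rightarrow> 'v set set \<Rightarrow> 'k set \<Rightarrow> ('v \<times> 'k \<Rightarrow> real) set" where
  "fractional_coloring_polytope V E K =
     {x \<in> vectors (V \<times> K).
        (\<forall>v\<in>V. (\<Sum>i\<in>K. x (v, i)) = 1) \<and>
        (\<forall>i\<in>K. \<forall>u v. {u, v} \<in> E \<longrightarrow> x (v, i) + x (u, i) \<le> 1) \<and>
        (\<forall>v\<in>V. \<forall>i\<in>K. x (v, i) \<ge> 0)}"

text \<open>
  The equality constraints are indexed by the vertices. The inequality constraints, written as
  \<open>B x \<le> d\<close>, are indexed by the following type; nonnegativity is \<open>- x (v, i) \<le> 0\<close>.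
\<close>

datatype ('v, 'k) ineq = EdgeIneq "'v set" 'k | Nonneg 'v 'k

definition ineqs :: "'v set \<Rightarrow> 'v set set \<Rightarrow> 'k set \<Rightarrow> ('v, 'k) ineq set" where
  "ineqs V E K = {EdgeIneq e i | e i. e \<in> E \<and> i \<in> K} \<union> {Nonneg v i | v i. v \<in> V \<and> i \<in> K}"

definition eq_mat :: "'v \<Rightarrow> 'v \<times> 'k \<Rightarrow> real" where
  "eq_mat v c = of_bool (fst c = v)"

fun ineq_mat :: "('v, 'k) ineq \<Rightarrow> 'v \<times> 'k \<Rightarrow> real" where
  "ineq_mat (EdgeIneq e i) c = of_bool (fst c \<in> e \<and> snd c = i)"
| "ineq_mat (Nonneg v i) c = - of_bool (c = (v, i))"

fun ineq_rhs :: "('v, 'k) ineq \<Rightarrow> real" where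
  "ineq_rhs (EdgeIneq e i) = 1"
| "ineq_rhs (Nonneg v i) = 0"

lemma mat_vec_eq_mat:
  assumes "finite V" "finite K" "v \<in> V"
  shows "mat_vec (V \<times> K) eq_mat x v = (\<Sum>i\<in>K. x (v, i))"
proof -
  have "mat_vec (V \<times> K) eq_mat x v = (\<Sum>u\<in>V. \<Sum>i\<in>K. of_bool (u = v) * x (u, i))"
    by (simp add: mat_vec_def eq_mat_def sum.cartesian_product case_prod_unfold)
  also have "\<dots> = (\<Sum>u\<in>V. if u = v then (\<Sum>i\<in>K. x (v, i)) else 0)"
    by (intro sum.cong) auto
  finally show ?thesis using assms by simp
qed

lemma mat_vec_EdgeIneq:
  assumes "finite V" "finite K" "i \<in> K" "u \<in> V" "v \<in> V" "u \<noteq> v"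
  shows "mat_vec (V \<times> K) ineq_mat x (EdgeIneq {u, v} i) = x (v, i) + x (u, i)"
proof -
  have "mat_vec (V \<times> K) ineq_mat x (EdgeIneq {u, v} i) =
      (\<Sum>c\<in>{(v, i), (u, i)}. ineq_mat (EdgeIneq {u, v} i) c * x c)"
    unfolding mat_vec_def using assms by (intro sum.mono_neutral_right) auto
  then show ?thesis using assms by simp
qed

lemma mat_vec_Nonneg:
  assumes "finite V" "finite K" "v \<in> V" "i \<in> K"
  shows "mat_vec (V \<times> K) ineq_mat x (Nonneg v i) = - x (v, i)"
proof -
  have "mat_vec (V \<times> K) ineq_mat x (Nonneg v i) =
      (\<Sum>c\<in>{(v, i)}. ineq_mat (Nonneg v i) c * x c)"
    unfolding mat_vec_def using assms by (intro sum.mono_neutral_right) auto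
  then show ?thesis by simp
qed

lemma fractional_coloring_polytope_matrices:
  assumes G: "simple_graph V E" and K: "finite K"
  shows "fractional_coloring_polytope V E K =
    {x \<in> vectors (V \<times> K).
       (\<forall>v\<in>V. mat_vec (V \<times> K) eq_mat x v = 1) \<and>
       (\<forall>r\<in>ineqs V E K. mat_vec (V \<times> K) ineq_mat x r \<le> ineq_rhs r)}"
proof -
  have V: "finite V" using G by (simp add: simple_graph_def)
  have edge: "u \<in> V \<and> v \<in> V \<and> u \<noteq> v" if "{u, v} \<in> E" for u v
    using G that unfolding simple_graph_def by fastforce
  have pair: "\<exists>u v. e = {u, v}" if "e \<in> E" for e
    using G that unfolding simple_graph_def by (meson card_2_iff)
  have ineq: "(\<forall>r\<in>ineqs V E K. mat_vec (V \<times> K) ineq_mat x r \<le> ineq_rhs r) \<longleftrightarrow>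
      (\<forall>i\<in>K. \<forall>u v. {u, v} \<in> E \<longrightarrow> x (v, i) + x (u, i) \<le> 1) \<and> (\<forall>v\<in>V. \<forall>i\<in>K. x (v, i) \<ge> 0)"
    (is "?L \<longleftrightarrow> ?R") for x
  proof
    assume L: ?L
    have "x (v, i) + x (u, i) \<le> 1" if "i \<in> K" "{u, v} \<in> E" for u v i
    proof -
      have "EdgeIneq {u, v} i \<in> ineqs V E K" using that by (auto simp: ineqs_def)
      with L have "mat_vec (V \<times> K) ineq_mat x (EdgeIneq {u, v} i) \<le> 1" by fastforce
      then show ?thesis using mat_vec_EdgeIneq[OF V K, of i u v x] edge that by simp
    qed
    moreover have "x (v, i) \<ge> 0" if "v \<in> V" "i \<in> K" for v i
    proof -
      have "Nonneg v i \<in> ineqs V E K" using that by (auto simp: ineqs_def)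
      with L have "mat_vec (V \<times> K) ineq_mat x (Nonneg v i) \<le> 0" by fastforce
      then show ?thesis using mat_vec_Nonneg[OF V K, of v i x] that by simp
    qed
    ultimately show ?R by blast
  next
    assume R: ?R
    show ?L
    proof
      fix r assume "r \<in> ineqs V E K"
      then consider e i where "r = EdgeIneq e i" "e \<in> E" "i \<in> K"
        | v i where "r = Nonneg v i" "v \<in> V" "i \<in> K"
        by (auto simp: ineqs_def)
      then show "mat_vec (V \<times> K) ineq_mat x r \<le> ineq_rhs r"
      proof cases
        case 1
        then obtain u v where e: "e = {u, v}" using pair by blast
        then show ?thesis using mat_vec_EdgeIneq[OF V K, of i u v x] edge[of u v] 1 R by simp
      next
        case 2
        then show ?thesis using mat_vec_Nonneg[OF V K, of v i x] R by simp
      qed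
    qed
  qed
  show ?thesis
    unfolding fractional_coloring_polytope_def ineq using mat_vec_eq_mat[OF V K] by auto
qed

definition coloring_imbalance :: "'v set \<Rightarrow> 'v set set \<Rightarrow> 'k set \<Rightarrow> real" where
  "coloring_imbalance V E K = circuit_imbalance (V \<times> K) V eq_mat (ineqs V E K) ineq_mat"

text \<open>
  Worst case over all graphs with \<open>n\<close> vertices, for \<open>k\<close> colors. The imbalance is invariant under
  renaming vertices and colors, so \<open>{..<n}\<close> and \<open>{..<k}\<close> represent all vertex and color sets.
\<close>

definition max_coloring_imbalance :: "nat \<Rightarrow> nat \<Rightarrow> real" where
  "max_coloring_imbalance k n =
     Max {coloring_imbalance {..<n} E {..<k} | E. simple_graph {..<n} E}"

end

theory Submission
  imports Defs
begin

text \<open>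
  The extremal graphs are the complete graphs, with six colors. A circuit of the coloring polytope
  is an integral table \<open>g\<close>, with vertices as rows and colors as columns, whose rows sum to \<open>0\<close> and
  which is determined up to a factor by its row sums together with the inequalities that vanish on
  it. In a complete graph these are the relations \<open>g (v, i) = 0\<close> and \<open>g (u, i) = - g (v, i)\<close>, for
  any two vertices (\<open>circuit_of_complete_graphI\<close>): a value may be copied with the opposite sign to
  any other vertex, but only within its color.

  Each row sum is one linear equation with coefficients \<open>0\<close> and \<open>\<plusminus>1\<close>. If the equations are solved one
  after the other, every new value is a signed sum of earlier values, one for each other color,
  and for a fixed number of colors the growth falls short of a factor \<open>2\<close> per vertex. Equations
  that have to be solved simultaneously can do better. The table \<open>gadget\<close> has six rows and six
  colors, is determined up to a factor (\<open>gadget_determined\<close>), and contains the values \<open>1\<close> and \<open>-64\<close>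
  in the same color: this is a factor \<open>2\<close> per vertex.

  Since both values have the same color, gadgets can be chained: the entry \<open>-64\<close> of one block of
  six vertices is the negated entry \<open>1\<close> of the next block, scaled by \<open>64\<close>. The resulting table
  \<open>cascade n\<close> is a circuit (\<open>cascade_circuit\<close>) with entries \<open>1\<close> and \<open>-64 ^ (n div 6)\<close>.

  That a single circuit bounds the imbalance from below also requires that the maxima range over
  finite sets. This holds because circuits with the same support are proportional, so that the
  ratios of their entries depend on the support only (\<open>finite_imbalance_ratios\<close>).
\<close>

section \<open>Finiteness of the set of imbalance ratios\<close>

lemma mat_vec_diff_scaled:
  "mat_vec C M (\<lambda>c. a * x c - b * y c) r = a * mat_vec C M x r - b * mat_vec C M y r"
  by (simp add: mat_vec_def sum_subtractf sum_distrib_left algebra_simps)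

lemma mat_ker_diff_scaled:
  assumes "x \<in> mat_ker R C A" "y \<in> mat_ker R C A"
  shows "(\<lambda>c. a * x c - b * y c) \<in> mat_ker R C A"
  using assms by (auto simp: mat_ker_def vectors_def mat_vec_diff_scaled)

text \<open>
  Two circuits with the same support can be combined to a kernel vector that vanishes in one more
  inequality. By minimality of the support this vector is \<open>0\<close>.
\<close>

lemma circuits_same_support_proportional:
  assumes inj: "\<And>x. x \<in> mat_ker RA C A \<Longrightarrow> support RB (mat_vec C B x) = {} \<Longrightarrow> x = (\<lambda>_. 0)"
    and g: "g \<in> circuits C RA A RB B" and h: "h \<in> circuits C RA A RB B"
    and supp: "support RB (mat_vec C B g) = support RB (mat_vec C B h)"
  obtains a where "a \<noteq> 0" "h = (\<lambda>c. a * g c)"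
proof -
  have gk: "g \<in> mat_ker RA C A" "g \<noteq> (\<lambda>_. 0)" and hk: "h \<in> mat_ker RA C A" "h \<noteq> (\<lambda>_. 0)"
    using g h by (auto simp: circuits_def)
  obtain r where r: "r \<in> support RB (mat_vec C B g)"
    using inj gk by blast
  define p where "p = mat_vec C B h r"
  define q where "q = mat_vec C B g r"
  have pq: "p \<noteq> 0" "q \<noteq> 0"
    using r supp by (auto simp: p_def q_def support_def)
  define x where "x = (\<lambda>c. p * g c - q * h c)"
  have Bx: "mat_vec C B x s = p * mat_vec C B g s - q * mat_vec C B h s" for s
    by (simp add: x_def mat_vec_diff_scaled)
  have "r \<notin> support RB (mat_vec C B x)"
    by (simp add: support_def Bx p_def q_def)
  moreover have "support RB (mat_vec C B x) \<subseteq> support RB (mat_vec C B g)"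
  proof
    fix s assume s: "s \<in> support RB (mat_vec C B x)"
    show "s \<in> support RB (mat_vec C B g)"
    proof (rule ccontr)
      assume "s \<notin> support RB (mat_vec C B g)"
      with s supp have "mat_vec C B g s = 0" "mat_vec C B h s = 0"
        by (auto simp: support_def)
      with s show False
        by (simp add: support_def Bx)
    qed
  qed
  ultimately have "support RB (mat_vec C B x) \<subset> support RB (mat_vec C B g)"
    using r by blast
  moreover have "x \<in> mat_ker RA C A"
    unfolding x_def using gk(1) hk(1) by (rule mat_ker_diff_scaled)
  ultimately have "x = (\<lambda>_. 0)"
    using g by (auto simp: circuits_def)
  then have "p * g c - q * h c = 0" for c
    unfolding x_def by meson
  then have "h = (\<lambda>c. (p / q) * g c)"
    using pq by (auto simp: field_simps)
  moreover have "p / q \<noteq> 0"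
    using pq by simp
  ultimately show thesis
    using that by blast
qed

text \<open>
  By proportionality, every ratio is already a ratio of entries of one chosen representative for
  each support, and there are finitely many supports.
\<close>

lemma finite_imbalance_ratios:
  assumes "finite C" "finite RB"
    and inj: "\<And>x. x \<in> mat_ker RA C A \<Longrightarrow> support RB (mat_vec C B x) = {} \<Longrightarrow> x = (\<lambda>_. 0)"
  shows "finite {\<bar>g i / g j\<bar> | g i j. g \<in> circuits C RA A RB B \<and> i \<in> C \<and> j \<in> C \<and> g j \<noteq> 0}"
    (is "finite ?ratios")
proof -
  define rep where
    "rep S = (SOME g. g \<in> circuits C RA A RB B \<and> support RB (mat_vec C B g) = S)" for S
  have "?ratios \<subseteq> (\<lambda>(S, i, j). \<bar>rep S i / rep S j\<bar>) ` (Pow RB \<times> C \<times> C)"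
  proof
    fix q assume "q \<in> ?ratios"
    then obtain g i j where q: "q = \<bar>g i / g j\<bar>" and g: "g \<in> circuits C RA A RB B"
      and ij: "i \<in> C" "j \<in> C"
      by blast
    define S where "S = support RB (mat_vec C B g)"
    have rep: "rep S \<in> circuits C RA A RB B \<and> support RB (mat_vec C B (rep S)) = S"
      unfolding rep_def by (rule someI[where x = g]) (simp add: g S_def)
    obtain a where a: "a \<noteq> 0" "rep S = (\<lambda>c. a * g c)"
      using circuits_same_support_proportional[OF inj g, of "rep S"] rep S_def by metis
    then have "q = \<bar>rep S i / rep S j\<bar>"
      by (simp add: q)
    moreover have "S \<in> Pow RB"
      by (auto simp: S_def support_def)
    ultimately show "q \<in> (\<lambda>(S, i, j). \<bar>rep S i / rep S j\<bar>) ` (Pow RB \<times> C \<times> C)"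
      using ij by (intro image_eqI[where x = "(S, i, j)"]) auto
  qed
  then show ?thesis
    by (rule finite_subset) (use assms(1,2) in simp)
qed

lemma finite_ineqs:
  assumes "simple_graph V E" "finite K"
  shows "finite (ineqs V E K)"
proof -
  have "finite V" "E \<subseteq> Pow V"
    using assms by (auto simp: simple_graph_def)
  then have "finite E"
    by (meson finite_Pow_iff finite_subset)
  have "ineqs V E K \<subseteq> (\<lambda>(e, i). EdgeIneq e i) ` (E \<times> K) \<union> (\<lambda>(v, i). Nonneg v i) ` (V \<times> K)"
    by (auto simp: ineqs_def)
  then show ?thesis
    by (rule finite_subset) (use \<open>finite V\<close> \<open>finite E\<close> \<open>finite K\<close> in auto)
qed

text \<open>The nonnegativity rows alone make the inequality matrix injective.\<close>

lemma vector_eq_0_if_ineq_support_empty: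
  assumes "finite V" "finite K" "x \<in> vectors (V \<times> K)"
    and "support (ineqs V E K) (mat_vec (V \<times> K) ineq_mat x) = {}"
  shows "x = (\<lambda>_. 0)"
proof
  fix p :: "'a \<times> 'b"
  obtain v i where p: "p = (v, i)" by (cases p)
  show "x p = 0"
  proof (cases "v \<in> V \<and> i \<in> K")
    case True
    then have "Nonneg v i \<in> ineqs V E K"
      by (auto simp: ineqs_def)
    then have "mat_vec (V \<times> K) ineq_mat x (Nonneg v i) = 0"
      using assms(4) by (auto simp: support_def)
    then show ?thesis
      using mat_vec_Nonneg[of V K v i x] assms(1,2) True p by simp
  next
    case False
    then show ?thesis
      using assms(3) p by (auto simp: vectors_def)
  qed
qed

lemma circuit_ratio_le_coloring_imbalance:
  assumes "simple_graph V E" "finite K"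
    and "g \<in> circuits (V \<times> K) V eq_mat (ineqs V E K) ineq_mat"
    and "p \<in> V \<times> K" "q \<in> V \<times> K" "g q \<noteq> 0"
  shows "\<bar>g p / g q\<bar> \<le> coloring_imbalance V E K"
proof -
  have V: "finite V"
    using assms(1) by (simp add: simple_graph_def)
  have "finite {\<bar>g i / g j\<bar> | g i j. g \<in> circuits (V \<times> K) V eq_mat (ineqs V E K) ineq_mat
      \<and> i \<in> V \<times> K \<and> j \<in> V \<times> K \<and> g j \<noteq> 0}"
  proof (rule finite_imbalance_ratios)
    show "x = (\<lambda>_. 0)" if "x \<in> mat_ker V (V \<times> K) eq_mat"
      "support (ineqs V E K) (mat_vec (V \<times> K) ineq_mat x) = {}" for x
      using vector_eq_0_if_ineq_support_empty[OF V \<open>finite K\<close> _ that(2)] that(1)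
      by (auto simp: mat_ker_def)
  qed (use V assms finite_ineqs in auto)
  then show ?thesis
    unfolding coloring_imbalance_def circuit_imbalance_def
    by (rule Max_ge) (use assms in blast)
qed

lemma coloring_imbalance_le_max:
  assumes "simple_graph {..<n} E"
  shows "coloring_imbalance {..<n} E {..<k} \<le> max_coloring_imbalance k n"
proof -
  have "{E. simple_graph {..<n} E} \<subseteq> Pow (Pow {..<n})"
    by (auto simp: simple_graph_def)
  then have "finite {E. simple_graph {..<n} E}"
    by (rule finite_subset) simp
  then have "finite ((\<lambda>E. coloring_imbalance {..<n} E {..<k}) ` {E. simple_graph {..<n} E})"
    by (rule finite_imageI)
  moreover have "(\<lambda>E. coloring_imbalance {..<n} E {..<k}) ` {E. simple_graph {..<n} E}
      = {coloring_imbalance {..<n} E {..<k} | E. simple_graph {..<n} E}"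
    by auto
  ultimately show ?thesis
    unfolding max_coloring_imbalance_def using assms by (intro Max_ge) auto
qed


section \<open>Circuits of complete graphs\<close>

definition complete_edges :: "'v set \<Rightarrow> 'v set set" where
  "complete_edges V = {e. e \<subseteq> V \<and> card e = 2}"

lemma simple_graph_complete_edges: "finite V \<Longrightarrow> simple_graph V (complete_edges V)"
  by (simp add: simple_graph_def complete_edges_def)

lemma mem_mat_ker_eq_mat:
  assumes "finite V" "finite K"
  shows "x \<in> mat_ker V (V \<times> K) eq_mat \<longleftrightarrow>
    x \<in> vectors (V \<times> K) \<and> (\<forall>v\<in>V. (\<Sum>i\<in>K. x (v, i)) = 0)"
  using assms by (auto simp: mat_ker_def mat_vec_eq_mat)

text \<open>
  A kernel vector \<open>x\<close> of strictly smaller support satisfies every relation of the two kinds below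
  that \<open>g\<close> satisfies. If these relations leave only the multiples of \<open>g\<close>, then \<open>x\<close> has the same
  support as \<open>g\<close> after all.
\<close>

lemma circuit_of_complete_graphI:
  assumes V: "finite V" and K: "finite K"
    and g: "g \<in> vectors (V \<times> K)" "\<And>v. v \<in> V \<Longrightarrow> (\<Sum>i\<in>K. g (v, i)) = 0" "g \<noteq> (\<lambda>_. 0)"
    and int: "coprime_integral (V \<times> K) g"
    and determined: "\<And>x. \<lbrakk>x \<in> vectors (V \<times> K);
        \<And>v. v \<in> V \<Longrightarrow> (\<Sum>i\<in>K. x (v, i)) = 0;
        \<And>v i. \<lbrakk>v \<in> V; i \<in> K; g (v, i) = 0\<rbrakk> \<Longrightarrow> x (v, i) = 0;
        \<And>u v i. \<lbrakk>u \<in> V; v \<in> V; i \<in> K; u \<noteq> v; g (u, i) + g (v, i) = 0\<rbrakk>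
          \<Longrightarrow> x (u, i) + x (v, i) = 0\<rbrakk> \<Longrightarrow> \<exists>a. x = (\<lambda>p. a * g p)"
  shows "g \<in> circuits (V \<times> K) V eq_mat (ineqs V (complete_edges V) K) ineq_mat"
proof -
  let ?supp = "\<lambda>x. support (ineqs V (complete_edges V) K) (mat_vec (V \<times> K) ineq_mat x)"
  have "\<not> ?supp x \<subset> ?supp g"
    if x: "x \<in> mat_ker V (V \<times> K) eq_mat" "x \<noteq> (\<lambda>_. 0)" for x
  proof
    assume less: "?supp x \<subset> ?supp g"
    have tight: "mat_vec (V \<times> K) ineq_mat x r = 0"
      if "r \<in> ineqs V (complete_edges V) K" "mat_vec (V \<times> K) ineq_mat g r = 0" for r
      using less that by (auto simp: support_def)
    have "\<exists>a. x = (\<lambda>p. a * g p)"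
    proof (rule determined)
      show "(\<Sum>i\<in>K. x (v, i)) = 0" if "v \<in> V" for v
        using x(1) that by (auto simp: mem_mat_ker_eq_mat[OF V K])
      show "x (v, i) = 0" if "v \<in> V" "i \<in> K" "g (v, i) = 0" for v i
        using tight[of "Nonneg v i"] that by (auto simp: mat_vec_Nonneg[OF V K] ineqs_def)
      show "x (u, i) + x (v, i) = 0"
        if "u \<in> V" "v \<in> V" "i \<in> K" "u \<noteq> v" "g (u, i) + g (v, i) = 0" for u v i
        using tight[of "EdgeIneq {v, u} i"] that
        by (auto simp: mat_vec_EdgeIneq[OF V K] ineqs_def complete_edges_def)
      show "x \<in> vectors (V \<times> K)"
        using x(1) by (simp add: mat_ker_def)
    qed
    then obtain a where a: "x = (\<lambda>p. a * g p)" by blast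
    have "mat_vec (V \<times> K) ineq_mat x r = a * mat_vec (V \<times> K) ineq_mat g r" for r
      by (simp add: a mat_vec_def sum_distrib_left algebra_simps)
    moreover have "a \<noteq> 0"
      using a x(2) by auto
    ultimately have "?supp x = ?supp g"
      by (simp add: support_def)
    with less show False by simp
  qed
  then show ?thesis
    using g int by (auto simp: circuits_def mem_mat_ker_eq_mat[OF V K])
qed


section \<open>A gadget on six vertices with amplification 64\<close>

text \<open>
  Rows are vertices and columns are colors. Up to sign each column contains a single nonzero value,
  with the exception of column \<open>0\<close>: there the last row collects the sum of the other columns. The
  signs are arranged such that in each of the columns \<open>1\<close> to \<open>5\<close> both signs occur, so that all
  nonzero entries of the column are linked by opposite pairs. The same holds for the entries \<open>\<plusminus>1\<close>
  of column \<open>0\<close>.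
\<close>

definition gadget :: "nat \<Rightarrow> nat \<Rightarrow> int" where
  "gadget r i =
    [[  1,  6,   0, -16,  9,   0],
     [  1,  6, -14,  16, -9,   0],
     [  0, -6,   0,  16,  9, -19],
     [ -1,  6, -14,   0,  9,   0],
     [  1, -6, -14,   0,  0,  19],
     [-64,  6,  14,  16,  9,  19]] ! r ! i"

lemma less_6_cases:
  fixes r :: nat
  assumes "r < 6"
  obtains "r = 0" | "r = 1" | "r = 2" | "r = 3" | "r = 4" | "r = 5"
  using assms by fastforce

lemma sum_lessThan_6: "(\<Sum>i<6. f i) = f 0 + f 1 + f 2 + f 3 + f 4 + f (5::nat)"
  for f :: "nat \<Rightarrow> 'a::comm_monoid_add"
  by (simp add: eval_nat_numeral)

lemma gadget_row_sum: "r < 6 \<Longrightarrow> (\<Sum>i<6. gadget r i) = 0"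
  by (erule less_6_cases) (simp_all add: sum_lessThan_6 gadget_def)

text \<open>
  The zeros and the opposite pairs leave one unknown \<open>y\<^sub>i\<close> for each column \<open>i \<ge> 1\<close>, and in column
  \<open>0\<close> the unknown \<open>b\<close> and the last entry. The six row sums then determine everything in terms of
  \<open>b\<close>.
\<close>

lemma gadget_determined:
  fixes X :: "nat \<Rightarrow> nat \<Rightarrow> real"
  assumes row: "\<And>r. r < 6 \<Longrightarrow> (\<Sum>i<6. X r i) = 0"
    and zero: "\<And>r i. \<lbrakk>r < 6; i < 6; gadget r i = 0\<rbrakk> \<Longrightarrow> X r i = 0"
    and opp: "\<And>r s i. \<lbrakk>r < 6; s < 6; i < 6; r \<noteq> s; gadget r i + gadget s i = 0\<rbrakk>
      \<Longrightarrow> X r i + X s i = 0"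
    and "r < 6" "i < 6"
  shows "X r i = X 0 0 * of_int (gadget r i)"
proof -
  have zeros: "X 0 2 = 0" "X 0 5 = 0" "X 1 5 = 0" "X 2 0 = 0" "X 2 2 = 0" "X 3 3 = 0" "X 3 5 = 0"
    "X 4 3 = 0" "X 4 4 = 0"
    by (rule zero; simp add: gadget_def)+
  define b y1 y2 y3 y4 y5 where y: "b = X 0 0" "y1 = X 5 1" "y2 = X 5 2" "y3 = X 5 3"
    "y4 = X 5 4" "y5 = X 5 5"
  have "X 0 0 + X 3 0 = 0" "X 1 0 + X 3 0 = 0" "X 4 0 + X 3 0 = 0"
    by (rule opp; simp add: gadget_def)+
  then have c0: "X 3 0 = - b" "X 1 0 = b" "X 4 0 = b"
    by (simp_all add: y)
  have "X 5 1 + X 2 1 = 0" "X 5 1 + X 4 1 = 0" "X 0 1 + X 2 1 = 0" "X 1 1 + X 2 1 = 0"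
    "X 3 1 + X 2 1 = 0"
    by (rule opp; simp add: gadget_def)+
  then have c1: "X 0 1 = y1" "X 1 1 = y1" "X 2 1 = - y1" "X 3 1 = y1" "X 4 1 = - y1" "X 5 1 = y1"
    by (simp_all add: y)
  have "X 5 2 + X 1 2 = 0" "X 5 2 + X 3 2 = 0" "X 5 2 + X 4 2 = 0"
    by (rule opp; simp add: gadget_def)+
  then have c2: "X 1 2 = - y2" "X 3 2 = - y2" "X 4 2 = - y2" "X 5 2 = y2"
    by (simp_all add: y)
  have "X 5 3 + X 0 3 = 0" "X 1 3 + X 0 3 = 0" "X 2 3 + X 0 3 = 0"
    by (rule opp; simp add: gadget_def)+
  then have c3: "X 0 3 = - y3" "X 1 3 = y3" "X 2 3 = y3" "X 5 3 = y3"
    by (simp_all add: y)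
  have "X 5 4 + X 1 4 = 0" "X 0 4 + X 1 4 = 0" "X 2 4 + X 1 4 = 0" "X 3 4 + X 1 4 = 0"
    by (rule opp; simp add: gadget_def)+
  then have c4: "X 0 4 = y4" "X 1 4 = - y4" "X 2 4 = y4" "X 3 4 = y4" "X 5 4 = y4"
    by (simp_all add: y)
  have "X 5 5 + X 2 5 = 0" "X 4 5 + X 2 5 = 0"
    by (rule opp; simp add: gadget_def)+
  then have c5: "X 2 5 = - y5" "X 4 5 = y5" "X 5 5 = y5"
    by (simp_all add: y)
  note vals = zeros c0 c1 c2 c3 c4 c5 y(1)[symmetric]
  have eqs: "b + y1 - y3 + y4 = 0" "b + y1 - y2 + y3 - y4 = 0" "- y1 + y3 + y4 - y5 = 0"
    "- b + y1 - y2 + y4 = 0" "b - y1 - y2 + y5 = 0" "X 5 0 + y1 + y2 + y3 + y4 + y5 = 0"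
    using row[of 0] row[of 1] row[of 2] row[of 3] row[of 4] row[of 5]
    by (simp_all add: sum_lessThan_6 vals del: One_nat_def)
  (* Rows 0 and 3 give y3 = 2 b + y2, and rows 3 and 1 then give y2 = 2 b + 2 y1. Rows 2 and 4
     both express y5; comparing them gives 3 y1 = 4 b + y2, hence y1 = 6 b. *)
  then have sol: "y1 = 6 * b" "y2 = 14 * b" "y3 = 16 * b" "y4 = 9 * b" "y5 = 19 * b"
    "X 5 0 = - 64 * b"
    by linarith+
  show ?thesis
    using \<open>r < 6\<close> \<open>i < 6\<close>
    by (elim less_6_cases) (simp_all only: vals sol, simp_all add: gadget_def)
qed


section \<open>Cascading the gadget\<close>

text \<open>
  The vertices that remain after division into blocks of six get the zero row, which is a row of
  vanishing inequalities.
\<close>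

definition cascade :: "nat \<Rightarrow> nat \<times> nat \<Rightarrow> int" where
  "cascade n = (\<lambda>(v, i). if v < 6 * (n div 6) \<and> i < 6
     then 64 ^ (v div 6) * gadget (v mod 6) i else 0)"

lemma cascade_block:
  "\<lbrakk>t < n div 6; r < 6; i < 6\<rbrakk> \<Longrightarrow> cascade n (6 * t + r, i) = 64 ^ t * gadget r i"
  by (simp add: cascade_def)

lemma cascade_row_sum: "(\<Sum>i<6. cascade n (v, i)) = 0"
  using gadget_row_sum[of "v mod 6"]
  by (cases "v < 6 * (n div 6)") (simp_all add: cascade_def flip: sum_distrib_left)

text \<open>
  Within a block all entries are determined by the first one, and the opposite pair formed by the
  last row of a block and the first row of the next block, in color \<open>0\<close>, fixes the factor between
  the two blocks.
\<close>

lemma cascade_determined: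
  fixes x :: "nat \<times> nat \<Rightarrow> real"
  assumes x: "x \<in> vectors ({..<n} \<times> {..<6})"
    and row: "\<And>v. v < n \<Longrightarrow> (\<Sum>i<6. x (v, i)) = 0"
    and zero: "\<And>v i. \<lbrakk>v < n; i < 6; cascade n (v, i) = 0\<rbrakk> \<Longrightarrow> x (v, i) = 0"
    and opp: "\<And>u v i. \<lbrakk>u < n; v < n; i < 6; u \<noteq> v; cascade n (u, i) + cascade n (v, i) = 0\<rbrakk>
      \<Longrightarrow> x (u, i) + x (v, i) = 0"
  shows "x = (\<lambda>p. x (0, 0) * of_int (cascade n p))"
proof -
  let ?m = "n div 6"
  have in_range: "6 * t + r < n" if "t < ?m" "r < 6" for t r
    using that by linarith
  have block: "x (6 * t + r, i) = x (6 * t, 0) * of_int (gadget r i)"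
    if t: "t < ?m" and "r < 6" "i < 6" for t r i
  proof -
    have "(\<lambda>r i. x (6 * t + r, i)) r i = (\<lambda>r i. x (6 * t + r, i)) 0 0 * of_int (gadget r i)"
    proof (rule gadget_determined)
      show "(\<Sum>i<6. x (6 * t + r, i)) = 0" if "r < 6" for r
        using row in_range t that by blast
      show "x (6 * t + r, i) = 0" if "r < 6" "i < 6" "gadget r i = 0" for r i
        using that t by (intro zero in_range) (simp_all add: cascade_block)
      show "x (6 * t + r, i) + x (6 * t + s, i) = 0"
        if "r < 6" "s < 6" "i < 6" "r \<noteq> s" "gadget r i + gadget s i = 0" for r s i
        using that t
        by (intro opp in_range) (simp_all add: cascade_block flip: distrib_left)
    qed (use that in auto)
    then show ?thesis by simp
  qed
  have scale: "x (6 * t, 0) = x (0, 0) * 64 ^ t" if "t < ?m" for t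
    using that
  proof (induction t)
    case (Suc t)
    have "x (6 * t + 5, 0) + x (6 * Suc t + 0, 0) = 0"
    proof (rule opp)
      show "cascade n (6 * t + 5, 0) + cascade n (6 * Suc t + 0, 0) = 0"
        using Suc.prems by (subst (1 2) cascade_block) (simp_all add: gadget_def)
    qed (use Suc.prems in_range[of t 5] in_range[of "Suc t" 0] in auto)
    moreover have "x (6 * t + 5, 0) = - 64 * x (6 * t, 0)"
      using block[of t 5 0] Suc.prems by (simp add: gadget_def)
    ultimately show ?case
      using Suc by simp
  qed simp
  show ?thesis
  proof
    fix p :: "nat \<times> nat"
    obtain v i where p: "p = (v, i)" by (cases p)
    consider "v < n" "i < 6" "v < 6 * ?m" | "v < n" "i < 6" "\<not> v < 6 * ?m" | "\<not> (v < n \<and> i < 6)"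
      by blast
    then show "x p = x (0, 0) * of_int (cascade n p)"
    proof cases
      case 1
      then have t: "v div 6 < ?m" by (simp add: less_mult_imp_div_less mult.commute)
      then have "x (6 * (v div 6) + v mod 6, i)
          = x (0, 0) * 64 ^ (v div 6) * of_int (gadget (v mod 6) i)"
        using block[of "v div 6" "v mod 6" i] scale[OF t] 1 by simp
      then show ?thesis
        using 1 by (simp add: p cascade_def)
    next
      case 2
      then have "cascade n (v, i) = 0" by (simp add: cascade_def)
      with 2 show ?thesis using zero by (simp add: p)
    next
      case 3
      then have "cascade n (v, i) = 0" by (auto simp: cascade_def)
      with 3 x show ?thesis by (auto simp: p vectors_def)
    qed
  qed
qed

lemma cascade_circuit:
  assumes "6 \<le> n"
  shows "(\<lambda>p. of_int (cascade n p)) \<in>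
    circuits ({..<n} \<times> {..<6}) {..<n} eq_mat (ineqs {..<n} (complete_edges {..<n}) {..<6}) ineq_mat"
proof (rule circuit_of_complete_graphI)
  have one: "cascade n (0, 0) = 1"
    using assms by (simp add: cascade_def gadget_def)
  then show "(\<lambda>p. real_of_int (cascade n p)) \<noteq> (\<lambda>_. 0)"
    by (metis of_int_1 zero_neq_one)
  have "cascade n (0, 0) \<in> cascade n ` ({..<n} \<times> {..<6})"
    using assms by (intro imageI) auto
  then have "Gcd (cascade n ` ({..<n} \<times> {..<6})) dvd 1"
    unfolding one by (rule Gcd_dvd)
  then have "Gcd (cascade n ` ({..<n} \<times> {..<6})) = 1"
    by simp
  then show "coprime_integral ({..<n} \<times> {..<6}) (\<lambda>p. of_int (cascade n p))"
    unfolding coprime_integral_def by blast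
  show "(\<lambda>p. real_of_int (cascade n p)) \<in> vectors ({..<n} \<times> {..<6})"
    by (auto simp: vectors_def cascade_def)
  show "(\<Sum>i<6. real_of_int (cascade n (v, i))) = 0" for v
    using cascade_row_sum[of n v] by (simp flip: of_int_sum)
  show "\<exists>a. x = (\<lambda>p. a * real_of_int (cascade n p))"
    if "x \<in> vectors ({..<n} \<times> {..<6})" "\<And>v. v \<in> {..<n} \<Longrightarrow> (\<Sum>i<6. x (v, i)) = 0"
      "\<And>v i. \<lbrakk>v \<in> {..<n}; i \<in> {..<6}; real_of_int (cascade n (v, i)) = 0\<rbrakk> \<Longrightarrow> x (v, i) = 0"
      "\<And>u v i. \<lbrakk>u \<in> {..<n}; v \<in> {..<n}; i \<in> {..<6}; u \<noteq> v;
        real_of_int (cascade n (u, i)) + real_of_int (cascade n (v, i)) = 0\<rbrakk>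
        \<Longrightarrow> x (u, i) + x (v, i) = 0" for x
  proof -
    have "x = (\<lambda>p. x (0, 0) * real_of_int (cascade n p))"
      by (rule cascade_determined) (use that in \<open>simp_all flip: of_int_add\<close>)
    then show ?thesis by blast
  qed
qed auto

lemma max_coloring_imbalance_ge:
  assumes "6 \<le> n"
  shows "64 ^ (n div 6) \<le> max_coloring_imbalance 6 n"
proof -
  define t where "t = n div 6 - 1"
  have t: "n div 6 = Suc t"
    using assms by (simp add: t_def div_greater_zero_iff)
  have last: "cascade n (6 * t + 5, 0) = - (64 ^ Suc t)"
    using t by (subst cascade_block) (simp_all add: gadget_def)
  have first: "cascade n (0, 0) = 1"
    using assms by (simp add: cascade_def gadget_def)
  have range: "6 * t + 5 < n"
    using t by linarith
  have "64 ^ (n div 6) = \<bar>real_of_int (cascade n (6 * t + 5, 0)) / real_of_int (cascade n (0, 0))\<bar>"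
    by (simp add: last first t)
  also have "\<dots> \<le> coloring_imbalance {..<n} (complete_edges {..<n}) {..<6::nat}"
    by (rule circuit_ratio_le_coloring_imbalance[OF _ _ cascade_circuit[OF assms]])
      (use assms range first in \<open>auto simp: simple_graph_complete_edges\<close>)
  also have "\<dots> \<le> max_coloring_imbalance 6 n"
    by (rule coloring_imbalance_le_max) (simp add: simple_graph_complete_edges)
  finally show ?thesis .
qed

theorem lemma3p8:
  shows "\<exists>k. (\<lambda>n. max_coloring_imbalance k n) \<in> \<Omega>(\<lambda>n. 2 ^ n)"
proof
  show "(\<lambda>n. max_coloring_imbalance 6 n) \<in> \<Omega>(\<lambda>n. 2 ^ n)"
  proof (rule landau_omega.bigI)
    (* Up to five vertices are left over by the blocks, which costs a factor 2 ^ 5. *)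
    show "(1 / 32 :: real) > 0" by simp
    show "\<forall>\<^sub>F n in sequentially. norm (max_coloring_imbalance 6 n) \<ge> 1 / 32 * norm (2 ^ n :: real)"
    proof (rule eventually_mono[OF eventually_ge_at_top[of 6]])
      fix n :: nat assume n: "6 \<le> n"
      have "(2 :: real) ^ n \<le> 2 ^ (5 + 6 * (n div 6))"
        by (rule power_increasing) linarith+
      also have "\<dots> = 32 * 64 ^ (n div 6)"
        by (simp add: power_add power_mult)
      also have "\<dots> \<le> 32 * max_coloring_imbalance 6 n"
        using max_coloring_imbalance_ge[OF n] by simp
      finally show "norm (max_coloring_imbalance 6 n) \<ge> 1 / 32 * norm (2 ^ n :: real)"
        by simp
    qed
  qed
qed

end
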